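(* Let $E=(M(1),\dots,M(n))$ be an ordered collection of multiplicity sequences and let $1\le i<j\le n$. Then $k_E(i,j)+1$ is the lowest level at which the $i$-th and the $j$-th branches are prevented from being glued in a tree of $\tau(E)$. That is: if $k_E(i,j)\neq+\infty$, then in no tree $T\in\tau(E)$ are the $i$-th and $j$-th branches glued at level $k_E(i,j)+1$, while for every level $l$ with $1\le l\le k_E(i,j)$ there is a tree in $\tau(E)$ in which the $i$-th and $j$-th branches are glued at level $l$; if $k_E(i,j)=+\infty$, there is no limitation on the level where the two branches have to split up, i.e. for every $l\ge 1$ there is a tree in $\tau(E)$ in which the $i$-th and $j$-th branches are glued at level $l$.
   Context: A multiplicity sequence is a sequence $M(i)=(m_{i,l})_{l\ge1}$ of positive integers with $m_{i,l}=1$ for all large $l$, such that for every $l\ge1$ there is an integer $s_{i,l}\ge l+1$ with $m_{i,l}=\sum_{k=l+1}^{s_{i,l}}m_{i,k}$ (the integer $s_{i,l}$ is then unique). For $i<j$ let $D(i,j)=\{k\ge 1: s_{i,k}\ne s_{j,k}\}$. If $D(i,j)\neq\emptyset$ put $k_E(i,j)=\min\{\min(s_{i,k},s_{j,k}):k\in D(i,j)\}$; if $D(i,j)=\emptyset$ (equivalently $M(i)=M(j)$) put $k_E(i,j)=+\infty$. Trees: consider trees with $n$ infinite branches whose nodes are vectors of $\mathbb N^n$ ($\mathbb N=\{0,1,2,\dots\}$); $\mathbf n_i^l$ denotes the node of the $i$-th branch at level $l\ge1$, and $\mathbf n_i^{l}$ is joined to $\mathbf n_i^{l+1}$. Two branches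 $i,j$ are glued at level $l$ if $\mathbf n_i^l$ and $\mathbf n_j^l$ are the same node; if they are glued at level $l$ they are glued at all lower levels. All branches are glued at level $1$ (the root is $\mathbf n_1^1$). $\tau(E)$ is the set of all such trees $T$ satisfying: (0) the $i$-th branch has multiplicity sequence $M(i)$, i.e. $\mathbf n_i^l[i]=m_{i,l}$ for all $i,l$, where $v[h]$ denotes the $h$-th component of $v$; (1) there is $L$ such that for all $l\ge L$ and all $i$, $\mathbf n_i^l=(0,\dots,0,1,0,\dots,0)$ with the $1$ in position $i$; (2) $\mathbf n_i^l[h]=0$ if and only if $\mathbf n_i^l$ is not in the $h$-th branch; (3) each $\mathbf n_i^l$ is equal, as a vector, to the sum of the nodes other than $\mathbf n_i^l$ itself in some finite subtree of $T$ rooted in $\mathbf n_i^l$. Thus $\mathbf n_i^l$ has $h$-th component $m_{h,l}$ if branches $h$ and $i$ are glued at level $l$, and $0$ otherwise. (These trees are exactly the multiplicity trees of local Arf good semigroups of $\mathbb N^n$ having branches $M(1),\dots,M(n)$.) *)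

theory Defs
  imports "HOL-Analysis.Finite_Cartesian_Product" "HOL-Library.Extended_Nat"
begin

text \<open>
  Sequences and levels are indexed by the natural numbers from 1 on; the values at index 0 are
  never used. The \<open>n\<close> branches are indexed by a finite linearly ordered type \<^typ>\<open>'n\<close>, so that
  \<open>n = CARD('n)\<close> and vectors with \<open>n\<close> natural components have type \<open>nat ^ 'n\<close>.
\<close>

definition multiplicity_sequence :: "(nat \<Rightarrow> nat) \<Rightarrow> bool" where
  "multiplicity_sequence m \<longleftrightarrow>
     (\<forall>l\<ge>1. m l > 0) \<and>
     (\<exists>N. \<forall>l\<ge>N. m l = 1) \<and>
     (\<forall>l\<ge>1. \<exists>s\<ge>l + 1. m l = (\<Sum>k = l + 1..s. m k))"

text \<open>The number \<open>s\<close> is unique for a multiplicity sequence, because its terms are positive.\<close>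

definition mult_s :: "(nat \<Rightarrow> nat) \<Rightarrow> nat \<Rightarrow> nat" where
  "mult_s m l = (THE s. s \<ge> l + 1 \<and> m l = (\<Sum>k = l + 1..s. m k))"

definition D_E :: "('n \<Rightarrow> nat \<Rightarrow> nat) \<Rightarrow> 'n \<Rightarrow> 'n \<Rightarrow> nat set" where
  "D_E E i j = {k. k \<ge> 1 \<and> mult_s (E i) k \<noteq> mult_s (E j) k}"

definition k_E :: "('n \<Rightarrow> nat \<Rightarrow> nat) \<Rightarrow> 'n \<Rightarrow> 'n \<Rightarrow> enat" where
  "k_E E i j =
     (if D_E E i j = {} then \<infinity>
      else enat (LEAST m. \<exists>k \<in> D_E E i j. m = min (mult_s (E i) k) (mult_s (E j) k)))"

text \<open>
  A tree with \<open>n\<close> infinite branches is given by the vectors \<open>T i l\<close> found on branch \<open>i\<close> at level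
  \<open>l\<close>. The same vector may occur at several levels of a branch, so a node is a vector together
  with its level. Identifying nodes of equal level and equal vector loses nothing: if branches
  \<open>i\<close> and \<open>j\<close> carry the same vector at level \<open>l\<close>, its component \<open>j\<close> is \<open>E j l > 0\<close>, and the
  condition on zero components in \<open>tau\<close> below then forces the node to lie on branch \<open>j\<close>.
\<close>

type_synonym 'n branches = "'n \<Rightarrow> nat \<Rightarrow> nat ^ 'n"

type_synonym 'n node = "nat \<times> (nat ^ 'n)"

definition node :: "'n::finite branches \<Rightarrow> 'n \<Rightarrow> nat \<Rightarrow> 'n node" where
  "node T i l = (l, T i l)"

definition branch :: "'n::finite branches \<Rightarrow> 'n \<Rightarrow> 'n node set" where
  "branch T i = {node T i l | l. l \<ge> 1}"

definition edges :: "'n::finite branches \<Rightarrow> ('n node \<times> 'n node) set" where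
  "edges T = {(node T i l, node T i (l + 1)) | i l. l \<ge> 1}"

definition glued :: "'n::finite branches \<Rightarrow> 'n \<Rightarrow> 'n \<Rightarrow> nat \<Rightarrow> bool" where
  "glued T i j l \<longleftrightarrow> node T i l = node T j l"

definition is_tree :: "'n::finite branches \<Rightarrow> bool" where
  "is_tree T \<longleftrightarrow>
     (\<forall>i j. glued T i j 1) \<and>
     (\<forall>i j l l'. 1 \<le> l' \<longrightarrow> l' \<le> l \<longrightarrow> glued T i j l \<longrightarrow> glued T i j l')"

text \<open>
  A subtree rooted in \<open>v\<close> is given by its set \<open>S\<close> of nodes. Edges point away from the root of the
  tree, so the last conjunct says that \<open>S\<close> is connected and consists of descendants of \<open>v\<close>.
\<close>

definition finite_subtree_rooted :: "'n::finite branches \<Rightarrow> 'n node \<Rightarrow> 'n node set \<Rightarrow> bool" where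
  "finite_subtree_rooted T v S \<longleftrightarrow>
     finite S \<and> S \<subseteq> (\<Union>i. branch T i) \<and> v \<in> S \<and>
     (\<forall>w\<in>S. (v, w) \<in> (edges T \<inter> S \<times> S)\<^sup>*)"

text \<open>
  In the last conjunct the sum runs over nodes, not over their vectors, so that a vector occurring
  at several levels of \<open>S\<close> is counted once per node.
\<close>

definition tau :: "('n::finite \<Rightarrow> nat \<Rightarrow> nat) \<Rightarrow> 'n branches set" where
  "tau E = {T.
     is_tree T \<and>
     (\<forall>i. \<forall>l\<ge>1. T i l $ i = E i l) \<and>
     (\<exists>L. \<forall>l\<ge>L. \<forall>i. T i l = axis i 1) \<and>
     (\<forall>i h. \<forall>l\<ge>1. T i l $ h = 0 \<longleftrightarrow> node T i l \<notin> branch T h) \<and>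
     (\<forall>i. \<forall>l\<ge>1. \<exists>S. finite_subtree_rooted T (node T i l) S \<and>
                   T i l = (\<Sum>w \<in> S - {node T i l}. snd w))}"

end

theory Submission
  imports Defs
begin

text \<open>
  By positivity, a subtree rooted in \<open>node T i l\<close> whose other nodes sum to \<open>T i l\<close> meets every
  branch \<open>h\<close> through its root exactly in the levels from \<open>l\<close> to \<open>mult_s (E h) l\<close>. If two branches
  have different such ends, the subtree contains one of them but not the other at the level just
  after the smaller end, so they are no longer glued there. Conversely, a family of gluings that
  avoids this conflict gives a tree of \<open>tau E\<close>, since the union of the paths from \<open>l\<close> to
  \<open>mult_s (E h) l\<close> is then a subtree as required. Hence one may separate all branches right after
  the root, except for \<open>i\<close> and \<open>j\<close>, which stay together up to any level at most \<open>k_E E i j\<close>.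
\<close>

section \<open>Uniqueness of the summation end \<open>mult_s\<close>\<close>

lemma mult_s_unique:
  assumes "multiplicity_sequence m" "1 \<le> l" "l + 1 \<le> s" "m l = (\<Sum>k = l + 1..s. m k)"
  shows "mult_s m l = s"
  unfolding mult_s_def
proof (rule the_equality)
  show "l + 1 \<le> s \<and> m l = (\<Sum>k = l + 1..s. m k)"
    using assms by simp
next
  fix s' assume s': "l + 1 \<le> s' \<and> m l = (\<Sum>k = l + 1..s'. m k)"
  have less: "(\<Sum>k = l + 1..a. m k) < (\<Sum>k = l + 1..b. m k)" if "a < b" "l + 1 \<le> a" for a b
  proof (rule sum_strict_mono2[where b = b])
    show "{l + 1..a} \<subseteq> {l + 1..b}" "b \<in> {l + 1..b} - {l + 1..a}"
      using that by auto
    show "0 < m b"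
      using assms(1) that unfolding multiplicity_sequence_def by simp
  qed auto
  show "s' = s"
    using less[of s s'] less[of s' s] s' assms by (metis less_irrefl linorder_neqE_nat)
qed

lemma mult_s_props:
  assumes "multiplicity_sequence m" "1 \<le> l"
  shows "l + 1 \<le> mult_s m l" "m l = (\<Sum>k = l + 1..mult_s m l. m k)"
proof -
  obtain s where "l + 1 \<le> s" "m l = (\<Sum>k = l + 1..s. m k)"
    using assms unfolding multiplicity_sequence_def by blast
  then show "l + 1 \<le> mult_s m l" "m l = (\<Sum>k = l + 1..mult_s m l. m k)"
    using mult_s_unique[OF assms] by simp_all
qed

section \<open>Levels met by a rooted subtree, and the obstruction to gluing\<close>

lemma node_eq_iff: "node T i l = node T j l' \<longleftrightarrow> l = l' \<and> T i l = T j l'"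
  by (auto simp: node_def)

lemma node_in_branch_iff: "1 \<le> l \<Longrightarrow> node T i l \<in> branch T h \<longleftrightarrow> glued T i h l"
  by (auto simp: branch_def glued_def node_eq_iff)

lemma finite_subtree_rooted_level_ge:
  assumes "finite_subtree_rooted T v S" "w \<in> S"
  shows "fst v \<le> fst w"
proof -
  have "(v, w) \<in> (edges T \<inter> S \<times> S)\<^sup>*"
    using assms by (auto simp: finite_subtree_rooted_def)
  then show ?thesis
    by (induction rule: rtrancl_induct) (auto simp: edges_def node_def)
qed

text \<open>The path from the root ends with an edge into the given node. That edge may be recorded
  along another branch \<open>g\<close>, but gluing at level \<open>Suc u\<close> passes down to
  level \<open>u\<close>, so its source is the node of branch \<open>i\<close> as well.\<close>

lemma finite_subtree_rooted_parent:
  assumes tree: "is_tree T" and S: "finite_subtree_rooted T v S"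
    and mem: "node T i (Suc u) \<in> S" and level: "fst v \<le> u" and pos: "1 \<le> u"
  shows "node T i u \<in> S"
proof -
  have "(v, node T i (Suc u)) \<in> (edges T \<inter> S \<times> S)\<^sup>*"
    using S mem by (auto simp: finite_subtree_rooted_def)
  moreover have "v \<noteq> node T i (Suc u)"
    using level by (auto simp: node_def)
  ultimately obtain x where x: "(x, node T i (Suc u)) \<in> edges T" "x \<in> S"
    by (auto elim: rtranclE)
  then obtain g where g: "x = node T g u" "node T i (Suc u) = node T g (Suc u)"
    by (auto simp: edges_def node_eq_iff)
  then have "glued T i g u"
    using tree pos unfolding is_tree_def glued_def by (metis le_Suc_eq order_refl)
  then show ?thesis
    using x g by (simp add: glued_def)
qed

text \<open>Taking component \<open>i\<close> of the vector equation leaves only the nodes on branch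
  \<open>i\<close>. Their levels form an interval starting at \<open>l\<close>, and its end is
  \<open>mult_s (E i) l\<close> by uniqueness.\<close>

lemma summing_subtree_levels:
  fixes E :: "'n::finite \<Rightarrow> nat \<Rightarrow> nat"
  assumes E: "multiplicity_sequence (E i)" and T: "T \<in> tau E" and l: "1 \<le> l"
    and S: "finite_subtree_rooted T (node T i l) S"
    and sum: "T i l = (\<Sum>w \<in> S - {node T i l}. snd w)"
    and u: "1 \<le> u"
  shows "node T i u \<in> S \<longleftrightarrow> l \<le> u \<and> u \<le> mult_s (E i) l"
proof -
  have tree: "is_tree T" and diag: "\<And>u. 1 \<le> u \<Longrightarrow> T i u $ i = E i u"
    and zero: "\<And>g u. 1 \<le> u \<Longrightarrow> T g u $ i = 0 \<longleftrightarrow> \<not> glued T g i u"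
    using T by (auto simp: tau_def node_in_branch_iff)
  have Epos: "E i l > 0"
    using E l by (auto simp: multiplicity_sequence_def)
  have root: "node T i l \<in> S"
    using S by (simp add: finite_subtree_rooted_def)
  define A where "A = {u. node T i u \<in> S}"
  have A_ge: "l \<le> u" if "u \<in> A" for u
    using finite_subtree_rooted_level_ge[OF S] that by (fastforce simp: A_def node_def)
  have inj: "inj_on (node T i) B" for B
    by (auto simp: inj_on_def node_eq_iff)
  have finS: "finite S"
    using S by (simp add: finite_subtree_rooted_def)
  \<comment> \<open>A node records its level, so distinct levels in \<open>A\<close> give distinct
    elements of the finite set \<open>S\<close>.\<close>
  have finA: "finite A"
    unfolding A_def by (rule finite_imageD[OF _ inj]) (rule finite_subset[OF _ finS], auto)
  define p where "p = Max A"
  have lA: "l \<in> A"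
    using root by (simp add: A_def)
  then have pA: "p \<in> A"
    using finA unfolding p_def by (intro Max_in) auto
  \<comment> \<open>Descending from the top level \<open>p\<close>, each parent stays in
    \<open>S\<close> as long as its level is at least \<open>l\<close>.\<close>
  have down: "u \<in> A" if "l \<le> u" "u \<le> p" for u
    using that(2,1)
  proof (induction rule: inc_induct)
    case base
    show ?case by (rule pA)
  next
    case (step u)
    then have "node T i (Suc u) \<in> S"
      by (simp add: A_def)
    then show ?case
      using finite_subtree_rooted_parent[OF tree S, of i u] step.prems l
      by (simp add: A_def node_def)
  qed
  have A_eq: "A = {l..p}"
  proof (intro equalityI subsetI)
    show "u \<in> {l..p}" if "u \<in> A" for u
      using A_ge[OF that] Max_ge[OF finA that] by (simp add: p_def)
    show "u \<in> A" if "u \<in> {l..p}" for u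
      using down that by simp
  qed
  have S_cases: "\<exists>g u. 1 \<le> u \<and> w = node T g u" if "w \<in> S" for w
    using S that unfolding finite_subtree_rooted_def branch_def by blast
  have "E i l = (\<Sum>w \<in> S - {node T i l}. snd w $ i)"
    using arg_cong[OF sum, of "\<lambda>v. v $ i"] diag[OF l] by simp
  \<comment> \<open>Nodes of \<open>S\<close> off branch \<open>i\<close> have component
    \<open>i\<close> equal to 0 and drop out.\<close>
  also have "\<dots> = (\<Sum>w \<in> node T i ` {l + 1..p}. snd w $ i)"
  proof (rule sum.mono_neutral_right)
    show "finite (S - {node T i l})"
      using finS by simp
    show "node T i ` {l + 1..p} \<subseteq> S - {node T i l}"
      using A_eq by (auto simp: A_def node_eq_iff)
    show "\<forall>w \<in> S - {node T i l} - node T i ` {l + 1..p}. snd w $ i = 0"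
    proof (rule ballI, rule ccontr)
      fix w assume w: "w \<in> S - {node T i l} - node T i ` {l + 1..p}" and "snd w $ i \<noteq> 0"
      obtain g u where gu: "1 \<le> u" "w = node T g u"
        using S_cases w by blast
      then have "glued T g i u"
        using \<open>snd w $ i \<noteq> 0\<close> zero by (simp add: node_def)
      then have wi: "w = node T i u"
        using gu by (simp add: glued_def)
      then have "u \<in> {l..p}" "u \<noteq> l"
        using w A_eq by (auto simp: A_def)
      then show False
        using w wi by auto
    qed
  qed
  also have "\<dots> = (\<Sum>u = l + 1..p. E i u)"
    using diag by (subst sum.reindex[OF inj]) (auto simp: node_def intro!: sum.cong)
  finally have *: "E i l = (\<Sum>u = l + 1..p. E i u)" .
  \<comment> \<open>Otherwise the sum would be empty, contradicting
    \<open>E i l > 0\<close>.\<close>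
  have "l + 1 \<le> p"
    using * Epos by (cases "l + 1 \<le> p") auto
  then have "mult_s (E i) l = p"
    using mult_s_unique[of "E i" l p] E l * by blast
  then show ?thesis
    using A_eq by (auto simp: A_def)
qed

lemma not_glued_after_mult_s:
  fixes E :: "'n::finite \<Rightarrow> nat \<Rightarrow> nat"
  assumes E: "\<And>h. multiplicity_sequence (E h)" and T: "T \<in> tau E" and k: "1 \<le> k"
    and lt: "mult_s (E i) k < mult_s (E j) k"
  shows "\<not> glued T i j (mult_s (E i) k + 1)"
proof
  let ?s = "mult_s (E i) k"
  assume glued: "glued T i j (?s + 1)"
  have "k + 1 \<le> ?s"
    using mult_s_props(1)[OF E k] .
  then have "k \<le> ?s + 1"
    by simp
  moreover have "is_tree T"
    using T by (simp add: tau_def)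
  \<comment> \<open>Both branches start from one node at level \<open>k\<close>, so a single subtree
    \<open>S\<close> is a summing subtree for each of them.\<close>
  ultimately have root: "node T i k = node T j k"
    using glued k unfolding is_tree_def glued_def by blast
  obtain S where S: "finite_subtree_rooted T (node T i k) S"
      "T i k = (\<Sum>w \<in> S - {node T i k}. snd w)"
    using T k unfolding tau_def by blast
  have S': "finite_subtree_rooted T (node T j k) S"
      "T j k = (\<Sum>w \<in> S - {node T j k}. snd w)"
    using S root by (simp_all add: node_eq_iff)
  have "node T j (?s + 1) \<in> S"
    using summing_subtree_levels[OF E T k S', of "?s + 1"] lt \<open>k + 1 \<le> ?s\<close> by simp
  moreover have "node T i (?s + 1) \<notin> S"
    using summing_subtree_levels[OF E T k S, of "?s + 1"] by simp
  ultimately show False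
    using glued by (simp add: glued_def)
qed

section \<open>Trees built from prescribed gluings\<close>

text \<open>\<open>G l i h\<close> prescribes that branches \<open>i\<close> and \<open>h\<close>
  share their node at level \<open>l\<close>; the conditions on diagonal and zero components then
  leave only these vectors.\<close>

definition gluing_tree ::
    "('n::finite \<Rightarrow> nat \<Rightarrow> nat) \<Rightarrow> (nat \<Rightarrow> 'n \<Rightarrow> 'n \<Rightarrow> bool) \<Rightarrow> 'n branches" where
  "gluing_tree E G i l = (\<chi> h. if G l i h then E h l else 0)"

text \<open>Component \<open>j\<close> of the vector of branch \<open>j\<close> is positive, so
  equal vectors force \<open>G l i j\<close>; conversely, equivalent indices have the same class and
  hence the same support.\<close>

lemma glued_gluing_tree_iff:
  assumes G: "equivp (G l)" and pos: "\<And>h. E h l > 0"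
  shows "glued (gluing_tree E G) i j l \<longleftrightarrow> G l i j"
proof
  assume "glued (gluing_tree E G) i j l"
  then have "gluing_tree E G i l $ j = gluing_tree E G j l $ j"
    by (simp add: glued_def node_eq_iff)
  then show "G l i j"
    using pos[of j] equivp_reflp[OF G] by (simp add: gluing_tree_def split: if_splits)
next
  assume "G l i j"
  then have "G l i h \<longleftrightarrow> G l j h" for h
    using G by (meson equivp_symp equivp_transp)
  then show "glued (gluing_tree E G) i j l"
    by (simp add: glued_def node_eq_iff gluing_tree_def)
qed

text \<open>In the union of the paths up to \<open>mult_s (E g) t\<close>, over all \<open>g\<close>
  glued to \<open>i\<close> at level \<open>t\<close>, \<open>compat\<close> keeps every node shared
  with a branch \<open>h\<close> within the range of \<open>h\<close>. So component \<open>h\<close>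
  of the sum counts each level from \<open>t + 1\<close> to \<open>mult_s (E h) t\<close> once,
  which gives \<open>E h t\<close>.\<close>

lemma gluing_tree_summing_subtree:
  fixes E :: "'n::finite \<Rightarrow> nat \<Rightarrow> nat"
  assumes E: "\<And>h. multiplicity_sequence (E h)"
    and G: "\<And>l. equivp (G l)"
    and down: "\<And>a b l l'. 1 \<le> l' \<Longrightarrow> l' \<le> l \<Longrightarrow> G l a b \<Longrightarrow> G l' a b"
    and compat: "\<And>a b t u. 1 \<le> t \<Longrightarrow> t < u \<Longrightarrow> G u a b \<Longrightarrow>
                   u \<le> mult_s (E a) t \<Longrightarrow> u \<le> mult_s (E b) t"
    and t: "1 \<le> t"
  defines "T \<equiv> gluing_tree E G"
  shows "\<exists>S. finite_subtree_rooted T (node T i t) S \<and> T i t = (\<Sum>w \<in> S - {node T i t}. snd w)"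
proof -
  have glued: "glued T a b u \<longleftrightarrow> G u a b" if "1 \<le> u" for a b u
    using glued_gluing_tree_iff[of G u E a b] G E that
    by (simp add: T_def multiplicity_sequence_def)
  have T_nth: "T a u $ h = (if G u a h then E h u else 0)" for a u h
    by (simp add: T_def gluing_tree_def)
  have refl: "G u a a" for u a
    using G equivp_reflp by metis
  \<comment> \<open>Levels start at \<open>t + 1\<close> to leave out the root. Different pairs may
    name the same glued node, so the sum must run over the image \<open>S'\<close>, not over
    \<open>P\<close>.\<close>
  define P where "P = (SIGMA g:{g. G t i g}. {t + 1..mult_s (E g) t})"
  define S' where "S' = (\<lambda>(g, u). node T g u) ` P"
  define S where "S = insert (node T i t) S'"
  have finS': "finite S'"
    by (simp add: S'_def P_def)
  have "node T i t \<notin> S'"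
    by (auto simp: S'_def P_def node_eq_iff)
  then have diff: "S - {node T i t} = S'"
    by (simp add: S_def)
  have mem: "node T g u \<in> S" if "G t i g" "t \<le> u" "u \<le> mult_s (E g) t" for g u
  proof (cases "u = t")
    case True
    then show ?thesis
      using glued[OF t, of i g] that(1) by (simp add: S_def glued_def)
  next
    case False
    then have "(g, u) \<in> P"
      using that by (simp add: P_def)
    then show ?thesis
      by (force simp: S_def S'_def)
  qed
  have path: "(node T i t, node T g u) \<in> (edges T \<inter> S \<times> S)\<^sup>*"
    if g: "G t i g" and u: "t \<le> u" "u \<le> mult_s (E g) t" for g u
    using u
  proof (induction rule: dec_induct)
    case base
    then show ?case
      using glued[OF t, of i g] g by (simp add: glued_def)
  next
    case (step u)
    have "(node T g u, node T g (Suc u)) \<in> edges T"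
      using step.hyps t unfolding edges_def by force
    moreover have "node T g u \<in> S" "node T g (Suc u) \<in> S"
      using mem[OF g] step.hyps step.prems by simp_all
    ultimately have "(node T g u, node T g (Suc u)) \<in> edges T \<inter> S \<times> S"
      by blast
    moreover have "(node T i t, node T g u) \<in> (edges T \<inter> S \<times> S)\<^sup>*"
      using step.IH step.prems by simp
    ultimately show ?case
      by (rule rtrancl_into_rtrancl[rotated])
  qed
  have "finite_subtree_rooted T (node T i t) S"
    unfolding finite_subtree_rooted_def
  proof (intro conjI ballI)
    show "finite S"
      using finS' by (simp add: S_def)
    show "S \<subseteq> (\<Union>i. branch T i)"
      using t by (force simp: S_def S'_def P_def branch_def)
    show "node T i t \<in> S"
      by (simp add: S_def)
    show "(node T i t, w) \<in> (edges T \<inter> S \<times> S)\<^sup>*" if "w \<in> S" for w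
      using that path by (auto simp: S_def S'_def P_def)
  qed
  moreover have "T i t = (\<Sum>w \<in> S'. snd w)"
  proof (rule vec_eq_iff[THEN iffD2], rule allI)
    fix h
    have meets: "G t i h \<and> w \<in> node T h ` {t + 1..mult_s (E h) t}"
      if w: "w \<in> S'" and nz: "snd w $ h \<noteq> 0" for w
    proof -
      obtain g u where gu: "w = node T g u" "G t i g" "t < u" "u \<le> mult_s (E g) t"
        using w by (auto simp: S'_def P_def)
      have gh: "G u g h"
        using nz gu by (simp add: node_def T_nth split: if_splits)
      then have "G t g h"
        using down[of t u g h] t gu by simp
      then have "G t i h"
        using gu G equivp_transp by metis
      moreover have "w = node T h u"
        using gh glued[of u g h] t gu by (simp add: glued_def)
      moreover have "u \<le> mult_s (E h) t"
        using compat[OF t _ gh] gu by simp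
      ultimately show ?thesis
        using gu by auto
    qed
    have "(\<Sum>w \<in> S'. snd w) $ h = (\<Sum>w \<in> S'. snd w $ h)"
      by simp
    also have "\<dots> = T i t $ h"
    proof (cases "G t i h")
      case False
      then have "(\<Sum>w \<in> S'. snd w $ h) = 0"
        using meets by (intro sum.neutral) blast
      then show ?thesis
        using False by (simp add: T_nth)
    next
      case True
      have "(\<Sum>w \<in> S'. snd w $ h) = (\<Sum>w \<in> node T h ` {t + 1..mult_s (E h) t}. snd w $ h)"
      proof (rule sum.mono_neutral_right)
        show "node T h ` {t + 1..mult_s (E h) t} \<subseteq> S'"
          using True by (force simp: S'_def P_def)
      qed (use finS' meets in blast)+
      also have "\<dots> = (\<Sum>u = t + 1..mult_s (E h) t. E h u)"
        by (subst sum.reindex) (auto simp: inj_on_def node_def T_nth refl)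
      also have "\<dots> = E h t"
        using mult_s_props(2)[OF E t] by simp
      finally show ?thesis
        using True by (simp add: T_nth)
    qed
    finally show "T i t $ h = (\<Sum>w \<in> S'. snd w) $ h"
      by simp
  qed
  ultimately show ?thesis
    using diff by metis
qed

text \<open>The hypotheses on \<open>G\<close> mirror the conditions on a tree: \<open>root\<close>
  and \<open>down\<close> give the tree shape, \<open>split\<close> serves the eventual unit
  vectors, and \<open>compat\<close> the sums over subtrees.\<close>

lemma gluing_tree_in_tau:
  fixes E :: "'n::finite \<Rightarrow> nat \<Rightarrow> nat"
  assumes E: "\<And>h. multiplicity_sequence (E h)"
    and G: "\<And>l. equivp (G l)"
    and root: "\<And>a b. G 1 a b"
    and down: "\<And>a b l l'. 1 \<le> l' \<Longrightarrow> l' \<le> l \<Longrightarrow> G l a b \<Longrightarrow> G l' a b"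
    and split: "\<And>a b l. N \<le> l \<Longrightarrow> G l a b \<Longrightarrow> a = b"
    and compat: "\<And>a b t u. 1 \<le> t \<Longrightarrow> t < u \<Longrightarrow> G u a b \<Longrightarrow>
                   u \<le> mult_s (E a) t \<Longrightarrow> u \<le> mult_s (E b) t"
  shows "gluing_tree E G \<in> tau E"
proof -
  let ?T = "gluing_tree E G"
  have glued: "glued ?T a b u \<longleftrightarrow> G u a b" if "1 \<le> u" for a b u
    using glued_gluing_tree_iff[of G u E a b] G E that
    by (simp add: multiplicity_sequence_def)
  have refl: "G u a a" for u a
    using G equivp_reflp by metis
  have "is_tree ?T"
    unfolding is_tree_def using glued root down by (metis order_refl order_trans)
  moreover have "?T i l $ i = E i l" for i l
    by (simp add: gluing_tree_def refl)
  moreover have "\<exists>L. \<forall>l\<ge>L. \<forall>i. ?T i l = axis i 1"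
  proof -
    have "\<forall>h. \<exists>M. \<forall>l\<ge>M. E h l = 1"
      using E by (simp add: multiplicity_sequence_def)
    then obtain M where M: "\<And>h l. M h \<le> l \<Longrightarrow> E h l = 1"
      by metis
    \<comment> \<open>From \<open>N\<close> on no two branches are glued, and from
      \<open>M h\<close> on branch \<open>h\<close> has multiplicity 1; finitely many branches allow
      a common bound.\<close>
    have "?T i l = axis i 1" if l: "max N (Max (range M)) \<le> l" for i l
    proof -
      have "M h \<le> l" for h
        using l Max_ge[of "range M" "M h"] by simp
      moreover have "G l i h \<longleftrightarrow> h = i" for h
        using split[of l i h] refl l by auto
      ultimately show ?thesis
        using M[of _ l] by (simp add: gluing_tree_def axis_def fun_eq_iff)
    qed
    then show ?thesis
      by blast
  qed
  moreover have "?T i l $ h = 0 \<longleftrightarrow> node ?T i l \<notin> branch ?T h" if "1 \<le> l" for i h l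
    using that E glued[OF that]
    by (simp add: node_in_branch_iff gluing_tree_def multiplicity_sequence_def)
  moreover have "\<exists>S. finite_subtree_rooted ?T (node ?T i l) S \<and>
      ?T i l = (\<Sum>w \<in> S - {node ?T i l}. snd w)" if "1 \<le> l" for i l
    using E G down compat that by (rule gluing_tree_summing_subtree)
  ultimately show ?thesis
    unfolding tau_def by blast
qed

lemma exists_tree_glued:
  fixes E :: "'n::finite \<Rightarrow> nat \<Rightarrow> nat"
  assumes E: "\<And>h. multiplicity_sequence (E h)" and l: "1 \<le> l"
    and bound: "\<And>k. k \<in> D_E E i j \<Longrightarrow> l \<le> min (mult_s (E i) k) (mult_s (E j) k)"
  shows "\<exists>T \<in> tau E. glued T i j l"
proof -
  \<comment> \<open>All branches meet at the root, and \<open>i\<close> and \<open>j\<close> alone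
    stay together up to level \<open>l\<close>.\<close>
  define G where "G = (\<lambda>t a b. a = b \<or> t \<le> 1 \<or> t \<le> l \<and> a \<in> {i, j} \<and> b \<in> {i, j})"
  have G: "equivp (G t)" for t
    by (rule equivpI) (auto simp: G_def reflp_def symp_def transp_def)
  have "gluing_tree E G \<in> tau E"
  proof (rule gluing_tree_in_tau[where N = "l + 1"])
    fix a b t u
    assume t: "1 \<le> t" "t < u" and ab: "G u a b" and u: "u \<le> mult_s (E a) t"
    show "u \<le> mult_s (E b) t"
    \<comment> \<open>For distinct \<open>a\<close> and \<open>b\<close>,
      \<open>u > t \<ge> 1\<close> excludes the root, so \<open>a\<close> and \<open>b\<close> are
      \<open>i\<close> and \<open>j\<close> in some order and \<open>u \<le> l\<close>. Then either
      the two ends agree at \<open>t\<close>, or \<open>bound\<close> places \<open>l\<close> below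
      both.\<close>
    proof (cases "a = b \<or> t \<notin> D_E E i j")
      case True
      then show ?thesis
        using t ab u by (auto simp: G_def D_E_def)
    next
      case False
      then show ?thesis
        using t ab bound[of t] by (auto simp: G_def)
    qed
  qed (use E G l in \<open>auto simp: G_def\<close>)
  moreover have "glued (gluing_tree E G) i j l"
    using glued_gluing_tree_iff[of G l E i j] G E l
    by (simp add: multiplicity_sequence_def) (simp add: G_def)
  ultimately show ?thesis
    by blast
qed

section \<open>The threshold level \<open>k_E\<close>\<close>

lemma glued_commute: "glued T i j l \<longleftrightarrow> glued T j i l"
  by (auto simp: glued_def)

theorem proposition1p2:
  fixes E :: "'n::{finite, linorder} \<Rightarrow> nat \<Rightarrow> nat" and i j :: 'n
  assumes "\<And>h. multiplicity_sequence (E h)"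
    and "i < j"
  shows "(\<forall>k. k_E E i j = enat k \<longrightarrow>
            (\<forall>T \<in> tau E. \<not> glued T i j (k + 1)) \<and>
            (\<forall>l. 1 \<le> l \<and> l \<le> k \<longrightarrow> (\<exists>T \<in> tau E. glued T i j l))) \<and>
         (k_E E i j = \<infinity> \<longrightarrow> (\<forall>l\<ge>1. \<exists>T \<in> tau E. glued T i j l))"
proof (cases "D_E E i j = {}")
  case True
  then have "\<exists>T \<in> tau E. glued T i j l" if "1 \<le> l" for l
    by (intro exists_tree_glued[OF assms(1) that]) simp
  then show ?thesis
    using True by (simp add: k_E_def)
next
  case False
  define Q where
    "Q = (\<lambda>m. \<exists>k \<in> D_E E i j. m = min (mult_s (E i) k) (mult_s (E j) k))"
  have k_E: "k_E E i j = enat (Least Q)"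
    using False by (simp add: k_E_def Q_def)
  have "\<exists>m. Q m"
    using False by (auto simp: Q_def)
  then have "Q (Least Q)"
    by (rule LeastI_ex)
  \<comment> \<open>The least value is attained at some index \<open>k\<close>, and the obstruction
    at that \<open>k\<close> already excludes gluing one level higher.\<close>
  then obtain k where k: "1 \<le> k" "mult_s (E i) k \<noteq> mult_s (E j) k"
      "Least Q = min (mult_s (E i) k) (mult_s (E j) k)"
    by (auto simp: Q_def D_E_def)
  have "\<not> glued T i j (Least Q + 1)" if T: "T \<in> tau E" for T
  \<comment> \<open>The obstruction is stated with the smaller end on the first branch, so the other
    case exchanges \<open>i\<close> and \<open>j\<close>.\<close>
  proof (cases "mult_s (E i) k < mult_s (E j) k")
    case True
    then show ?thesis
      using not_glued_after_mult_s[OF assms(1) T k(1)] k(3) by (simp add: min_def)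
  next
    case False
    then show ?thesis
      using not_glued_after_mult_s[OF assms(1) T k(1), of j i] k(2,3)
      by (simp add: min_def glued_commute[of T i j])
  qed
  moreover have "\<exists>T \<in> tau E. glued T i j l" if "1 \<le> l" "l \<le> Least Q" for l
  proof (rule exists_tree_glued[OF assms(1) that(1)])
    fix k assume "k \<in> D_E E i j"
    then have "Least Q \<le> min (mult_s (E i) k) (mult_s (E j) k)"
      by (intro Least_le[of Q]) (auto simp: Q_def)
    then show "l \<le> min (mult_s (E i) k) (mult_s (E j) k)"
      using that(2) by simp
  qed
  ultimately show ?thesis
    using k_E by simp
qed

end
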